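(* Let $(\mathbb{X},\|\cdot\|_{\mathbb{X}})$ be a real normed space, let $\mathbb{S}$ be a nonempty subset of $\mathbb{X}$, let $f:\mathbb{S}\to\mathbb{R}\cup\{+\infty\}$ be a proper function, and let $\overline{x}\in\mathbb{S}$ with $f(\overline{x})$ finite. If $f$ is radially epidifferentiable at $\overline{x}$, then $f$ is lower semicontinuous at $\overline{x}$.
   Context: For a nonempty subset $A$ of a real normed space and $a\in A$, the closed radial cone is $R(A;a)=\mathrm{cl}(\mathrm{cone}(A-a))$, i.e. the set of all $w$ for which there are $\lambda_n>0$ and $a_n\in A$ with $\lim_{n\to\infty}\lambda_n(a_n-a)=w$. The epigraph of $f$ is $\mathrm{epi}\,f=\{(x,y)\in\mathbb{S}\times\mathbb{R}: f(x)\le y\}$. The radial epiderivative $f^r(\overline{x};\cdot)$ of $f$ at $\overline{x}$ is the function defined by $\mathrm{epi}\,f^r(\overline{x};\cdot)=R(\mathrm{epi}\,f;(\overline{x},f(\overline{x})))$; thus $f^r(\overline{x};h)=\inf\{y\in\mathbb{R}:(h,y)\in R(\mathrm{epi}\,f;(\overline{x},f(\overline{x})))\}$ for $h\in\mathbb{X}$. The function $f$ is called radially epidifferentiable at $\overline{x}$ if $f^r(\overline{x};h)$ exists and is finite for every $h\in\mathbb{X}$. Lower semicontinuity at $\overline{x}$ means $\liminf_{x\to\overline{x}}f(x)\ge f(\overline{x})$. *)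

theory Defs
  imports "HOL-Analysis.Analysis"
begin

(* A function f from S to the reals with infinities is a total function into ereal of which only
   the values on S are used. *)

definition proper_on :: "'a set \<Rightarrow> ('a \<Rightarrow> ereal) \<Rightarrow> bool" where
  "proper_on S f \<longleftrightarrow> (\<forall>x\<in>S. f x \<noteq> -\<infinity>) \<and> (\<exists>x\<in>S. f x \<noteq> \<infinity>)"

definition ereal_epigraph :: "'a set \<Rightarrow> ('a \<Rightarrow> ereal) \<Rightarrow> ('a \<times> real) set" where
  "ereal_epigraph S f = {(x, y). x \<in> S \<and> f x \<le> ereal y}"

definition closed_radial_cone :: "'a::real_normed_vector set \<Rightarrow> 'a \<Rightarrow> 'a set" where
  "closed_radial_cone A a = closure (cone hull ((\<lambda>z. z - a) ` A))"

(* real_of_ereal maps the infinities to 0, so this is meant for f x finite.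
   The function g is uniquely determined, and given by an infimum; see below. *)
definition is_radial_epiderivative ::
    "'a::real_normed_vector set \<Rightarrow> ('a \<Rightarrow> ereal) \<Rightarrow> 'a \<Rightarrow> ('a \<Rightarrow> ereal) \<Rightarrow> bool" where
  "is_radial_epiderivative S f x g \<longleftrightarrow>
     ereal_epigraph UNIV g = closed_radial_cone (ereal_epigraph S f) (x, real_of_ereal (f x))"

definition radially_epidifferentiable ::
    "'a::real_normed_vector set \<Rightarrow> ('a \<Rightarrow> ereal) \<Rightarrow> 'a \<Rightarrow> bool" where
  "radially_epidifferentiable S f x \<longleftrightarrow>
     (\<exists>g. is_radial_epiderivative S f x g \<and> (\<forall>h. \<bar>g h\<bar> \<noteq> \<infinity>))"

lemma mem_closed_radial_cone_iff:
  assumes "a \<in> A"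
  shows "w \<in> closed_radial_cone A a \<longleftrightarrow>
    (\<exists>(c :: nat \<Rightarrow> real) z. (\<forall>n. c n > 0 \<and> z n \<in> A) \<and> (\<lambda>n. c n *\<^sub>R (z n - a)) \<longlonglongrightarrow> w)"
    (is "?L \<longleftrightarrow> ?R")
proof
  assume ?L
  then obtain s where s: "\<And>n. s n \<in> cone hull ((\<lambda>z. z - a) ` A)" and lim: "s \<longlonglongrightarrow> w"
    unfolding closed_radial_cone_def closure_sequential by auto
  have "\<exists>c z. c > 0 \<and> z \<in> A \<and> s n = c *\<^sub>R (z - a)" for n
  proof -
    obtain c z where cz: "c \<ge> 0" "z \<in> A" "s n = c *\<^sub>R (z - a)"
      using s[of n] unfolding cone_hull_expl by auto
    show ?thesis
    proof (cases "c = 0")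
      case True
      then have "(1::real) > 0 \<and> a \<in> A \<and> s n = 1 *\<^sub>R (a - a)" using cz assms by simp
      then show ?thesis by blast
    next
      case False
      then have "c > 0" using cz by simp
      then show ?thesis using cz by blast
    qed
  qed
  then obtain c z where "\<And>n. c n > 0 \<and> z n \<in> A \<and> s n = c n *\<^sub>R (z n - a)" by metis
  moreover from this have "s = (\<lambda>n. c n *\<^sub>R (z n - a))" by auto
  ultimately show ?R using lim by blast
next
  assume ?R
  then obtain c :: "nat \<Rightarrow> real" and z
    where cz: "\<And>n. c n > 0 \<and> z n \<in> A" and lim: "(\<lambda>n. c n *\<^sub>R (z n - a)) \<longlonglongrightarrow> w" by blast
  have "c n *\<^sub>R (z n - a) \<in> cone hull ((\<lambda>z. z - a) ` A)" for n
    unfolding cone_hull_expl using cz[of n] by (auto intro: less_imp_le)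
  then show ?L
    unfolding closed_radial_cone_def closure_sequential using lim
    by (intro CollectI exI[of _ "\<lambda>n. c n *\<^sub>R (z n - a)"] conjI allI)
qed

lemma is_radial_epiderivative_imp_eq:
  assumes "is_radial_epiderivative S f x g"
  shows "g h = (INF y \<in> {y. (h, y) \<in>
    closed_radial_cone (ereal_epigraph S f) (x, real_of_ereal (f x))}. ereal y)"
proof -
  have "{y. (h, y) \<in> closed_radial_cone (ereal_epigraph S f) (x, real_of_ereal (f x))}
      = {y. g h \<le> ereal y}"
    using assms unfolding is_radial_epiderivative_def ereal_epigraph_def by force
  moreover have "(INF y \<in> {y. g h \<le> ereal y}. ereal y) = g h"
  proof (rule antisym)
    show "g h \<le> (INF y \<in> {y. g h \<le> ereal y}. ereal y)" by (auto intro: INF_greatest)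
    show "(INF y \<in> {y. g h \<le> ereal y}. ereal y) \<le> g h"
    proof (rule ereal_le_real)
      fix z assume "g h \<le> ereal z"
      then show "(INF y \<in> {y. g h \<le> ereal y}. ereal y) \<le> ereal z"
        by (intro INF_lower) auto
    qed
  qed
  ultimately show ?thesis by simp
qed

lemma closed_radial_cone_epigraph_upward:
  assumes x: "x \<in> S" "\<bar>f x\<bar> \<noteq> \<infinity>"
    and w: "(h, y) \<in> closed_radial_cone (ereal_epigraph S f) (x, real_of_ereal (f x))"
    and le: "y \<le> y'"
  shows "(h, y') \<in> closed_radial_cone (ereal_epigraph S f) (x, real_of_ereal (f x))"
proof -
  let ?a = "(x, real_of_ereal (f x))"
  have a: "?a \<in> ereal_epigraph S f"
    using x by (simp add: ereal_epigraph_def ereal_real)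
  obtain c :: "nat \<Rightarrow> real" and z where cz: "\<And>n. c n > 0 \<and> z n \<in> ereal_epigraph S f"
    and lim: "(\<lambda>n. c n *\<^sub>R (z n - ?a)) \<longlonglongrightarrow> (h, y)"
    using w unfolding mem_closed_radial_cone_iff[OF a] by blast
  define z' where "z' n = z n + (0, (y' - y) / c n)" for n
  have z': "z' n \<in> ereal_epigraph S f" for n
  proof -
    have "0 \<le> (y' - y) / c n" using cz[of n] le by simp
    then have "ereal (snd (z n)) \<le> ereal (snd (z n) + (y' - y) / c n)" by simp
    then show ?thesis
      using cz[of n] unfolding z'_def ereal_epigraph_def
      by (cases "z n") (auto intro: order_trans)
  qed
  have "c n *\<^sub>R (z' n - ?a) = c n *\<^sub>R (z n - ?a) + (0, y' - y)" for n
  proof -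
    have "c n \<noteq> 0" using cz[of n] by simp
    then have "c n *\<^sub>R (0 :: 'a, (y' - y) / c n) = (0, y' - y)" by simp
    moreover have "z' n - ?a = (z n - ?a) + (0, (y' - y) / c n)" by (simp add: z'_def)
    ultimately show ?thesis by (metis scaleR_add_right)
  qed
  moreover have "(\<lambda>n. c n *\<^sub>R (z n - ?a) + (0, y' - y)) \<longlonglongrightarrow> (h, y) + (0, y' - y)"
    by (intro tendsto_intros lim)
  ultimately have "(\<lambda>n. c n *\<^sub>R (z' n - ?a)) \<longlonglongrightarrow> (h, y')" by simp
  then show ?thesis unfolding mem_closed_radial_cone_iff[OF a] using cz z' by blast
qed

lemma is_radial_epiderivative_INF:
  assumes x: "x \<in> S" "\<bar>f x\<bar> \<noteq> \<infinity>"
  shows "is_radial_epiderivative S f x (\<lambda>h. INF y \<in> {y. (h, y) \<in>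
    closed_radial_cone (ereal_epigraph S f) (x, real_of_ereal (f x))}. ereal y)"
proof -
  let ?R = "closed_radial_cone (ereal_epigraph S f) (x, real_of_ereal (f x))"
  have "(h, r) \<in> ?R" if le: "(INF y \<in> {y. (h, y) \<in> ?R}. ereal y) \<le> ereal r" for h r
  proof -
    have "(h, r + 1 / real (Suc n)) \<in> ?R" for n
    proof -
      have "(INF y \<in> {y. (h, y) \<in> ?R}. ereal y) < ereal (r + 1 / real (Suc n))"
        using le by (rule le_less_trans) simp
      then obtain y where y: "(h, y) \<in> ?R" "y < r + 1 / real (Suc n)"
        by (auto simp: INF_less_iff)
      show ?thesis
        by (rule closed_radial_cone_epigraph_upward[where f = f, OF x y(1)])
          (rule less_imp_le[OF y(2)])
    qed
    moreover have "(\<lambda>n. (h, r + 1 / real (Suc n))) \<longlonglongrightarrow> (h, r + 0)"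
      by (intro tendsto_intros LIMSEQ_Suc[OF lim_1_over_n])
    moreover have "closed ?R" by (simp add: closed_radial_cone_def)
    ultimately show ?thesis
      using closed_sequentially[of ?R "\<lambda>n. (h, r + 1 / real (Suc n))" "(h, r + 0)"] by simp
  qed
  moreover have "(INF y \<in> {y. (h, y) \<in> ?R}. ereal y) \<le> ereal r" if "(h, r) \<in> ?R" for h r
    using that by (intro INF_lower) simp
  ultimately have "(INF y \<in> {y. (h, y) \<in> ?R}. ereal y) \<le> ereal r \<longleftrightarrow> (h, r) \<in> ?R" for h r
    by (rule iffI)
  then show ?thesis
    unfolding is_radial_epiderivative_def ereal_epigraph_def by (simp only: UNIV_I simp_thms)
      (simp only: split_def prod.collapse Collect_mem_eq)
qed

end

theory Submission
  imports Defs
begin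

text \<open>If the lower limit were below \<open>f xbar\<close>, points of the epigraph at a fixed height
  below \<open>f xbar\<close> would accumulate over \<open>xbar\<close>, so the radial cone would contain a vector
  \<open>(0, -d)\<close> with \<open>d > 0\<close>. Being a cone it then contains \<open>(0, -t d)\<close> for all \<open>t > 0\<close>, which
  forces the radial epiderivative to be \<open>-\<infinity>\<close> in direction \<open>0\<close>.\<close>

lemma cone_closed_radial_cone: "cone (closed_radial_cone A a)"
  unfolding closed_radial_cone_def by (intro cone_closure cone_cone_hull)

text \<open>Points \<open>(x, r)\<close> of the epigraph with \<open>x\<close> near
  \<open>xbar\<close> have differences \<open>(x - xbar, r - b)\<close> from the apex, and these
  approach \<open>(0, r - b)\<close>. The scaling factor 1 is enough, so the cone hull enters only
  as a superset of the translated epigraph.\<close>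

lemma vertical_in_closed_radial_cone_epigraph:
  assumes freq: "\<exists>\<^sub>F x in at xbar within S. f x \<le> ereal r"
  shows "(0, r - b) \<in> closed_radial_cone (ereal_epigraph S f) (xbar, b)"
  unfolding closed_radial_cone_def closure_approachable
proof (intro allI impI)
  fix e :: real
  assume "e > 0"
  then have "\<forall>\<^sub>F x in at xbar within S. x \<in> S \<and> dist x xbar < e"
    unfolding eventually_at by blast
  with freq obtain x where x: "f x \<le> ereal r" "x \<in> S" "dist x xbar < e"
    using frequently_ex[OF frequently_eventually_conj] by blast
  let ?C = "(\<lambda>z. z - (xbar, b)) ` ereal_epigraph S f"
  have "(x, r) - (xbar, b) \<in> ?C"
    using x by (intro imageI) (simp add: ereal_epigraph_def)
  then have "(x - xbar, r - b) \<in> cone hull ?C"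
    using hull_subset[of ?C cone] by auto
  moreover have "dist (x - xbar, r - b) (0, r - b) < e"
    using x(3) by (simp add: dist_Pair_Pair dist_norm)
  ultimately show "\<exists>y\<in>cone hull ?C. dist y (0, r - b) < e" by blast
qed

lemma vertical_notin_closed_radial_cone_epigraph:
  assumes g: "is_radial_epiderivative S f x g" and fin: "\<bar>g 0\<bar> \<noteq> \<infinity>" and "d < 0"
  shows "(0, d) \<notin> closed_radial_cone (ereal_epigraph S f) (x, real_of_ereal (f x))"
    (is "_ \<notin> ?R")
proof
  assume d: "(0, d) \<in> ?R"
  obtain y where y: "g 0 = ereal y"
    using fin by auto
  \<comment> \<open>This factor stretches \<open>(0, d)\<close> down to a height strictly below
    \<open>y\<close>, the value of \<open>g\<close> at 0, hence out of the epigraph of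
    \<open>g\<close>.\<close>
  define c where "c = (\<bar>y\<bar> + 1) / - d"
  have "c *\<^sub>R (0, d) \<in> ?R"
    using cone_closed_radial_cone d \<open>d < 0\<close> unfolding cone_def c_def
    by (metis abs_ge_zero add_nonneg_nonneg divide_nonneg_pos neg_0_less_iff_less zero_le_one)
  moreover have "c * d = - (\<bar>y\<bar> + 1)"
    using \<open>d < 0\<close> by (simp add: c_def)
  ultimately have "(0, - (\<bar>y\<bar> + 1)) \<in> ereal_epigraph UNIV g"
    using g by (simp add: is_radial_epiderivative_def)
  then show False
    using y by (auto simp: ereal_epigraph_def abs_if split: if_splits)
qed

theorem theorem5:
  fixes S :: "'a::real_normed_vector set" and f :: "'a \<Rightarrow> ereal" and xbar :: 'a
  assumes "S \<noteq> {}"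
    and "proper_on S f"
    and "xbar \<in> S"
    and "\<bar>f xbar\<bar> \<noteq> \<infinity>"
    and "radially_epidifferentiable S f xbar"
  shows "f xbar \<le> Liminf (at xbar within S) f"
  unfolding le_Liminf_iff
proof (intro allI impI)
  fix y
  assume "y < f xbar"
  \<comment> \<open>The level \<open>r\<close> has to be real to serve as a height in the epigraph,
    whereas \<open>y\<close> may be infinite. The gap below \<open>f xbar\<close> makes the vertical
    vector point strictly downwards.\<close>
  then obtain r where r: "y < ereal r" "ereal r < f xbar"
    using ereal_dense2 by blast
  obtain g where g: "is_radial_epiderivative S f xbar g" "\<bar>g 0\<bar> \<noteq> \<infinity>"
    using assms(5) unfolding radially_epidifferentiable_def by auto
  have "r - real_of_ereal (f xbar) < 0"
    using r(2) assms(4) by (cases "f xbar") auto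
  then have "\<not> (\<exists>\<^sub>F x in at xbar within S. f x \<le> ereal r)"
    using vertical_in_closed_radial_cone_epigraph vertical_notin_closed_radial_cone_epigraph[OF g]
    by blast
  then have "\<forall>\<^sub>F x in at xbar within S. ereal r < f x"
    by (simp add: not_frequently not_le)
  then show "\<forall>\<^sub>F x in at xbar within S. y < f x"
    by (rule eventually_mono) (use r(1) in \<open>rule less_trans\<close>)
qed

end
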